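(* For a function $f\colon\mathbb{R}\to\mathbb{R}$ the following are equivalent: (i) $f$ is the pointwise limit of a sequence of Świątkowski functions; (ii) $f\in\mathfrak{S}$, i.e. $f$ has the Baire property and, for every residual set $A\subset\mathbb{R}$ and every $\varepsilon>0$, $f$ satisfies the condition $S(A,\varepsilon)$.
   Context: $\mathrm{C}(f)$ denotes the set of continuity points of $f$. $f$ is a Świątkowski function if for all $a<b$ with $f(a)\ne f(b)$ there is $x\in(a,b)\cap\mathrm{C}(f)$ with $f(x)$ strictly between $f(a)$ and $f(b)$. A function has the Baire property if preimages of open sets have the Baire property; a set is residual if its complement is meager. For $a,b\in\mathbb{R}$, $I(a,b)$ is the open interval with end-points $a,b$. For $A\subset\mathbb{R}$, an interval $J$ and $\varepsilon\ge0$, $f$ satisfies $S(J,A,\varepsilon)$ if for all $a,b\in J$ with $f(a)<f(b)$ there exists $x\in A\cap I(a,b)$ with $f(x)\in(f(a)-\varepsilon,f(b)+\varepsilon)$. $f$ satisfies $S(A,\varepsilon)$ if the union of all open intervals $J$ for which $f$ satisfies $S(J,A,\varepsilon)$ is dense in $\mathbb{R}$. $\mathfrak{S}$ denotes the class of all functions with the Baire property that satisfy $S(A,\varepsilon)$ for all residual $A\subset\mathbb{R}$ and all $\varepsilon>0$. *)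

theory Defs
  imports "HOL-Analysis.Analysis"
begin

definition cont_points :: "(real \<Rightarrow> real) \<Rightarrow> real set" where
  "cont_points f = {x. isCont f x}"

definition swiatkowski :: "(real \<Rightarrow> real) \<Rightarrow> bool" where
  "swiatkowski f \<longleftrightarrow> (\<forall>a b. a < b \<and> f a \<noteq> f b \<longrightarrow>
     (\<exists>x\<in>{a<..<b} \<inter> cont_points f. min (f a) (f b) < f x \<and> f x < max (f a) (f b)))"

definition nowhere_dense :: "real set \<Rightarrow> bool" where
  "nowhere_dense S \<longleftrightarrow> interior (closure S) = {}"

definition meager :: "real set \<Rightarrow> bool" where
  "meager S \<longleftrightarrow> (\<exists>F. countable F \<and> (\<forall>N\<in>F. nowhere_dense N) \<and> S \<subseteq> \<Union>F)"

definition residual :: "real set \<Rightarrow> bool" where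
  "residual A \<longleftrightarrow> meager (- A)"

definition has_baire_property_set :: "real set \<Rightarrow> bool" where
  "has_baire_property_set S \<longleftrightarrow> (\<exists>U. open U \<and> meager ((S - U) \<union> (U - S)))"

definition has_baire_property :: "(real \<Rightarrow> real) \<Rightarrow> bool" where
  "has_baire_property f \<longleftrightarrow> (\<forall>V. open V \<longrightarrow> has_baire_property_set (f -` V))"

definition oint :: "real \<Rightarrow> real \<Rightarrow> real set" where
  "oint a b = {min a b<..<max a b}"

definition S_on :: "(real \<Rightarrow> real) \<Rightarrow> real set \<Rightarrow> real set \<Rightarrow> real \<Rightarrow> bool" where
  "S_on f J A \<epsilon> \<longleftrightarrow> (\<forall>a\<in>J. \<forall>b\<in>J. f a < f b \<longrightarrow>
     (\<exists>x\<in>A \<inter> oint a b. f a - \<epsilon> < f x \<and> f x < f b + \<epsilon>))"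

definition S_cond :: "(real \<Rightarrow> real) \<Rightarrow> real set \<Rightarrow> real \<Rightarrow> bool" where
  "S_cond f A \<epsilon> \<longleftrightarrow>
     closure (\<Union>{J. (\<exists>c d. c < d \<and> J = {c<..<d}) \<and> S_on f J A \<epsilon>}) = UNIV"

definition frakS :: "(real \<Rightarrow> real) set" where
  "frakS = {f. has_baire_property f \<and> (\<forall>A \<epsilon>. residual A \<and> \<epsilon> > 0 \<longrightarrow> S_cond f A \<epsilon>)}"

end

theory Submission
  imports Defs
begin

text \<open>
  If Swiatkowski functions \<open>g n\<close> tend to \<open>f\<close>, then on a residual set \<open>B\<close> all \<open>g n\<close> are continuous, and
  by Baire's theorem every open set contains an interval on which \<open>g n\<close> is uniformly close to \<open>f\<close>
  along \<open>B\<close>. There the points that the Swiatkowski property provides for \<open>g n\<close> can be moved into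
  \<open>A \<inter> B\<close>, where they serve for \<open>f\<close>.

  Conversely, let \<open>f\<close> be continuous on the residual set \<open>R\<close>. Choose successively finer families \<open>\<C> n\<close>
  of disjoint open intervals with dense union, on each of which \<open>f\<close> oscillates by at most \<open>e n\<close>
  along \<open>R\<close> and satisfies \<open>S(I, R, e n)\<close>. Let \<open>g n\<close> equal \<open>f\<close> on the complement \<open>M n\<close> of the union, and
  on each interval oscillate near both ends around a value of \<open>f\<close>. The amplitude is \<open>2 * e k\<close> on
  intervals that come close to \<open>M (Suc k)\<close> but not to \<open>M k\<close>: if \<open>a, b \<in> M n\<close> lie in one interval of
  \<open>\<C> k\<close> but are separated by \<open>M (Suc k)\<close>, then \<open>S(I, R, e k)\<close> leaves no room for \<open>f a\<close> and \<open>f b\<close> to lie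
  on the same side of the values taken by \<open>g n\<close> between them. Each point outside all \<open>M k\<close> is
  eventually far from every single \<open>M k\<close>, so the amplitudes tend to \<open>0\<close> there.
\<close>

section \<open>Meager and residual sets\<close>

lemma meager_subset: "meager T \<Longrightarrow> S \<subseteq> T \<Longrightarrow> meager S"
  unfolding meager_def by (meson order_trans)

lemma meager_UN:
  assumes "\<And>n::nat. meager (S n)"
  shows "meager (\<Union>n. S n)"
proof -
  have "\<forall>n. \<exists>F. countable F \<and> (\<forall>N\<in>F. nowhere_dense N) \<and> S n \<subseteq> \<Union>F"
    using assms by (simp add: meager_def)
  then obtain F where F: "\<And>n. countable (F n)" "\<And>n. \<forall>N\<in>F n. nowhere_dense N"
      "\<And>n. S n \<subseteq> \<Union>(F n)"
    by metis
  show ?thesis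
    unfolding meager_def
  proof (intro exI conjI)
    show "countable (\<Union>n. F n)" using F(1) by simp
    show "\<forall>N\<in>\<Union>n. F n. nowhere_dense N" using F(2) by simp
    show "(\<Union>n. S n) \<subseteq> \<Union>(\<Union>n. F n)" using F(3) by blast
  qed
qed

lemma residual_superset: "residual S \<Longrightarrow> S \<subseteq> T \<Longrightarrow> residual T"
  unfolding residual_def by (rule meager_subset) auto

lemma residual_INF: "(\<And>n::nat. residual (S n)) \<Longrightarrow> residual (\<Inter>n. S n)"
  using meager_UN[of "\<lambda>n. - S n"] by (simp add: residual_def)

lemma residual_Int:
  assumes "residual S" "residual T"
  shows "residual (S \<inter> T)"
proof -
  have "residual (\<Inter>n::nat. if n = 0 then S else T)"
    using assms by (intro residual_INF) auto
  then show ?thesis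
    by (rule residual_superset) (auto split: if_splits dest: spec[of _ 0] spec[of _ 1])
qed

lemma closure_eq_UNIV_iff:
  "closure S = UNIV \<longleftrightarrow> (\<forall>U. open U \<and> U \<noteq> {} \<longrightarrow> S \<inter> U \<noteq> {})"
  for S :: "'a::topological_space set"
proof
  assume "closure S = UNIV"
  then show "\<forall>U. open U \<and> U \<noteq> {} \<longrightarrow> S \<inter> U \<noteq> {}"
    using open_Int_closure_eq_empty[of _ S] by (metis Int_UNIV_right Int_commute)
next
  assume *: "\<forall>U. open U \<and> U \<noteq> {} \<longrightarrow> S \<inter> U \<noteq> {}"
  have "S \<inter> (- closure S) = {}"
    using closure_subset by blast
  with * have "- closure S = {}"
    by (metis closed_closure open_Compl)
  then show "closure S = UNIV" by blast
qed

lemma residual_open_dense: "open U \<Longrightarrow> closure U = UNIV \<Longrightarrow> residual U"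
  unfolding residual_def meager_def nowhere_dense_def
  by (rule exI[of _ "{- U}"]) (simp add: closure_complement interior_open interior_complement)

text \<open>The Baire category theorem, applied to the complements of the closures of the nowhere
  dense sets that cover \<open>- A\<close>: these are open and dense, and their intersection lies in
  \<open>A\<close>.\<close>

lemma residual_inter_open:
  assumes "residual A" "open U" "U \<noteq> {}"
  shows "A \<inter> U \<noteq> {}"
proof -
  obtain F where F: "countable F" "\<And>N. N \<in> F \<Longrightarrow> nowhere_dense N" "- A \<subseteq> \<Union>F"
    using assms(1) by (auto simp: residual_def meager_def)
  define \<G> where "\<G> = (\<lambda>N. - closure N) ` F"
  have "UNIV \<subseteq> closure (\<Inter>\<G>)"
  proof (rule Baire)
    show "countable \<G>" using F(1) by (simp add: \<G>_def)
    fix T assume "T \<in> \<G>"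
    then obtain N where "N \<in> F" "T = - closure N" by (auto simp: \<G>_def)
    then show "openin (top_of_set UNIV) T \<and> UNIV \<subseteq> closure T"
      using F(2)[of N] by (auto simp: nowhere_dense_def closure_complement)
  qed auto
  then have "\<Inter>\<G> \<inter> U \<noteq> {}"
    using assms closure_eq_UNIV_iff by blast
  moreover have "\<Inter>\<G> \<subseteq> A"
  proof
    fix x assume x: "x \<in> \<Inter>\<G>"
    have "x \<notin> N" if "N \<in> F" for N
      using x that closure_subset[of N] unfolding \<G>_def by blast
    then show "x \<in> A" using F(3) by blast
  qed
  ultimately show ?thesis by blast
qed

lemma open_contains_interval:
  fixes U :: "real set"
  assumes "open U" "x \<in> U"
  obtains c d where "c < x" "x < d" "{c..d} \<subseteq> U"
proof -
  obtain e where "e > 0" "cball x e \<subseteq> U"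
    using assms open_contains_cball by blast
  then show ?thesis
    using that[of "x - e" "x + e"] by (auto simp: cball_eq_atLeastAtMost)
qed

section \<open>Continuity on residual sets\<close>

text \<open>For a countable base, discard the meager sets in which the preimages of its members
  differ from open sets; on the rest, the preimage of any open set is the trace of an open set.
  Conversely, a preimage that is such a trace on \<open>R\<close> differs from the open set only
  outside \<open>R\<close>.\<close>

lemma has_baire_property_iff_continuous_on_residual:
  "has_baire_property f \<longleftrightarrow> (\<exists>R. residual R \<and> continuous_on R f)"
proof
  assume f: "has_baire_property f"
  obtain B :: "nat \<Rightarrow> real set" where B: "\<And>n. open (B n)"
      "\<And>S. open S \<Longrightarrow> \<exists>k. S = \<Union>(B ` k)"
  proof -
    obtain \<B> :: "real set set" where \<B>: "countable \<B>" "topological_basis \<B>"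
      using ex_countable_basis by blast
    then have range: "range (from_nat_into (insert {} \<B>)) = insert {} \<B>"
      by (intro range_from_nat_into) auto
    show ?thesis
    proof (rule that)
      show "open (from_nat_into (insert {} \<B>) n)" for n
        using range topological_basis_open[OF \<B>(2)] by (metis insertE open_empty rangeI)
      fix S :: "real set" assume "open S"
      then obtain \<B>' where "\<B>' \<subseteq> \<B>" "S = \<Union>\<B>'"
        using \<B>(2) unfolding topological_basis_def by metis
      moreover from this have "\<B>' \<subseteq> range (from_nat_into (insert {} \<B>))"
        unfolding range by blast
      ultimately show "\<exists>k. S = \<Union>(from_nat_into (insert {} \<B>) ` k)"
        by (metis subset_imageE)
    qed
  qed
  have "\<forall>n. \<exists>U. open U \<and> meager ((f -` B n - U) \<union> (U - f -` B n))"
    using f B(1) by (simp add: has_baire_property_def has_baire_property_set_def)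
  then obtain U where U: "\<And>n. open (U n)"
      "\<And>n. meager ((f -` B n - U n) \<union> (U n - f -` B n))"
    by metis
  define R where "R = - (\<Union>n. (f -` B n - U n) \<union> (U n - f -` B n))"
  have "residual R"
    unfolding residual_def R_def double_complement by (rule meager_UN) (rule U(2))
  moreover have "continuous_on R f"
    unfolding continuous_on_open_invariant
  proof (intro allI impI)
    fix S :: "real set" assume "open S"
    then obtain k where k: "S = \<Union>(B ` k)" using B(2) by metis
    have "\<Union>(U ` k) \<inter> R = f -` S \<inter> R"
      by (auto simp: k R_def)
    moreover have "open (\<Union>(U ` k))" using U(1) by blast
    ultimately show "\<exists>A. open A \<and> A \<inter> R = f -` S \<inter> R" by metis
  qed
  ultimately show "\<exists>R. residual R \<and> continuous_on R f" by blast
next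
  assume "\<exists>R. residual R \<and> continuous_on R f"
  then obtain R where R: "residual R" "continuous_on R f" by blast
  show "has_baire_property f"
    unfolding has_baire_property_def has_baire_property_set_def
  proof (intro allI impI)
    fix V :: "real set" assume "open V"
    then obtain U where U: "open U" "U \<inter> R = f -` V \<inter> R"
      using R(2)[unfolded continuous_on_open_invariant] by blast
    then have "(f -` V - U) \<union> (U - f -` V) \<subseteq> - R" by blast
    then show "\<exists>U. open U \<and> meager ((f -` V - U) \<union> (U - f -` V))"
      using R(1) U(1) meager_subset unfolding residual_def by metis
  qed
qed

text \<open>The points with a neighbourhood of oscillation at most \<open>1 / real (Suc n)\<close>
  along \<open>B\<close> form an open set, dense by assumption; \<open>G\<close> is the intersection
  over all \<open>n\<close>. Taking \<open>B = UNIV\<close> yields genuine continuity points, while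
  a limit function can only be controlled along a residual \<open>B\<close>.\<close>

lemma residual_small_oscillation:
  fixes f :: "real \<Rightarrow> real"
  assumes "\<And>U e. open U \<Longrightarrow> U \<noteq> {} \<Longrightarrow> e > 0 \<Longrightarrow>
    \<exists>J. open J \<and> J \<inter> U \<noteq> {} \<and> (\<forall>y\<in>J \<inter> B. \<forall>z\<in>J \<inter> B. \<bar>f y - f z\<bar> \<le> e)"
  obtains G where "residual G" "continuous_on (G \<inter> B) f"
    "\<And>x e. x \<in> G \<Longrightarrow> e > 0 \<Longrightarrow>
      \<exists>J. open J \<and> x \<in> J \<and> (\<forall>y\<in>J \<inter> B. \<forall>z\<in>J \<inter> B. \<bar>f y - f z\<bar> < e)"
proof -
  define H where "H n = \<Union>{J. open J \<and> (\<forall>y\<in>J \<inter> B. \<forall>z\<in>J \<inter> B. \<bar>f y - f z\<bar> \<le> 1 / real (Suc n))}" for n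
  have "residual (H n)" for n
  proof (rule residual_open_dense)
    show "open (H n)" by (auto simp: H_def)
    show "closure (H n) = UNIV"
      unfolding closure_eq_UNIV_iff
    proof (intro allI impI)
      fix U :: "real set" assume U: "open U \<and> U \<noteq> {}"
      then have "\<exists>J. open J \<and> J \<inter> U \<noteq> {} \<and>
          (\<forall>y\<in>J \<inter> B. \<forall>z\<in>J \<inter> B. \<bar>f y - f z\<bar> \<le> 1 / real (Suc n))"
        by (intro assms) auto
      then show "H n \<inter> U \<noteq> {}" unfolding H_def by blast
    qed
  qed
  then have res: "residual (\<Inter>n. H n)" by (rule residual_INF)
  have osc: "\<exists>J. open J \<and> x \<in> J \<and> (\<forall>y\<in>J \<inter> B. \<forall>z\<in>J \<inter> B. \<bar>f y - f z\<bar> < e)"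
    if x: "x \<in> (\<Inter>n. H n)" and "e > 0" for x e
  proof -
    obtain n where n: "1 / real (Suc n) < e"
      using \<open>e > 0\<close> nat_approx_posE by blast
    have "x \<in> H n" using x by blast
    then obtain J where J: "open J" "x \<in> J"
        "\<forall>y\<in>J \<inter> B. \<forall>z\<in>J \<inter> B. \<bar>f y - f z\<bar> \<le> 1 / real (Suc n)"
      unfolding H_def by blast
    have "\<forall>y\<in>J \<inter> B. \<forall>z\<in>J \<inter> B. \<bar>f y - f z\<bar> < e"
      using J(3) n by (meson le_less_trans)
    with J show ?thesis by blast
  qed
  have "continuous_on ((\<Inter>n. H n) \<inter> B) f"
    unfolding continuous_on_topological
  proof (intro ballI allI impI)
    fix x V assume x: "x \<in> (\<Inter>n. H n) \<inter> B" and V: "open V" "f x \<in> V"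
    then obtain e where e: "e > 0" "ball (f x) e \<subseteq> V" by (meson open_contains_ball)
    obtain J where J: "open J" "x \<in> J" "\<forall>y\<in>J \<inter> B. \<forall>z\<in>J \<inter> B. \<bar>f y - f z\<bar> < e"
      using osc[OF IntD1[OF x] e(1)] by blast
    have "f y \<in> V" if "y \<in> (\<Inter>n. H n) \<inter> B" "y \<in> J" for y
    proof -
      have "\<bar>f x - f y\<bar> < e" using J(2) J(3)[rule_format, of x y] x that by simp
      then show ?thesis using e(2) by (auto simp: dist_real_def)
    qed
    with J show "\<exists>A. open A \<and> x \<in> A \<and> (\<forall>y\<in>(\<Inter>n. H n) \<inter> B. y \<in> A \<longrightarrow> f y \<in> V)" by blast
  qed
  with res osc that show ?thesis by blast
qed

lemma isCont_small_oscillation: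
  fixes f :: "real \<Rightarrow> real"
  assumes "isCont f x" "e > 0"
  obtains J where "open J" "x \<in> J" "\<And>y z. y \<in> J \<Longrightarrow> z \<in> J \<Longrightarrow> \<bar>f y - f z\<bar> \<le> e"
proof -
  have "open (ball (f x) (e / 2))" "f x \<in> ball (f x) (e / 2)" using assms(2) by auto
  then obtain J where J: "open J" "x \<in> J" "\<forall>y\<in>J. f y \<in> ball (f x) (e / 2)"
    using assms(1) unfolding continuous_at_open by blast
  have "\<bar>f y - f z\<bar> \<le> e" if "y \<in> J" "z \<in> J" for y z
  proof -
    have "dist (f x) (f y) < e / 2" "dist (f x) (f z) < e / 2" using J that by auto
    then show ?thesis unfolding dist_real_def by linarith
  qed
  with J that show ?thesis by blast
qed

text \<open>On an interval such a function is either constant or has a continuity point between two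
  points with different values. So continuity points are dense, and each has neighbourhoods of
  arbitrarily small oscillation, which is what the preceding category argument needs.\<close>

lemma swiatkowski_residual_cont_points:
  assumes "swiatkowski f"
  shows "residual (cont_points f)"
proof -
  have dense: "cont_points f \<inter> U \<noteq> {}" if "open U" "U \<noteq> {}" for U
  proof -
    obtain x where "x \<in> U" using \<open>U \<noteq> {}\<close> by blast
    then obtain c d where cd: "c < x" "x < d" "{c..d} \<subseteq> U"
      using open_contains_interval[OF \<open>open U\<close>] by metis
    show ?thesis
    proof (cases "\<exists>a\<in>{c..d}. \<exists>b\<in>{c..d}. a < b \<and> f a \<noteq> f b")
      case True
      then obtain a b where ab: "a \<in> {c..d}" "b \<in> {c..d}" "a < b" "f a \<noteq> f b" by blast
      then have "\<exists>z\<in>{a<..<b} \<inter> cont_points f. min (f a) (f b) < f z \<and> f z < max (f a) (f b)"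
        using assms[unfolded swiatkowski_def, rule_format, of a b] by blast
      then obtain z where "z \<in> {a<..<b}" "z \<in> cont_points f" by blast
      with ab have "z \<in> cont_points f \<inter> {c..d}" by simp
      with cd show ?thesis by blast
    next
      case False
      have const: "f y = f x" if "y \<in> {c<..<d}" for y
      proof (cases x y rule: linorder_cases)
        case less
        with False that cd show ?thesis by (fastforce dest: bspec[of _ _ x] bspec[of _ _ y])
      next
        case greater
        with False that cd show ?thesis by (fastforce dest: bspec[of _ _ x] bspec[of _ _ y])
      qed simp
      have "isCont f x"
      proof (rule continuous_on_interior)
        show "continuous_on {c<..<d} f"
          using const by (subst continuous_on_cong[OF refl, of _ f "\<lambda>_. f x"]) auto
        show "x \<in> interior {c<..<d}" using cd by (simp add: interior_open)
      qed
      then show ?thesis using \<open>x \<in> U\<close> by (auto simp: cont_points_def)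
    qed
  qed
  obtain G where G: "residual G" "\<And>x e. x \<in> G \<Longrightarrow> e > 0 \<Longrightarrow>
      \<exists>J. open J \<and> x \<in> J \<and> (\<forall>y\<in>J \<inter> UNIV. \<forall>z\<in>J \<inter> UNIV. \<bar>f y - f z\<bar> < e)"
      "continuous_on (G \<inter> UNIV) f"
  proof (rule residual_small_oscillation[of UNIV f])
    fix U :: "real set" and e :: real assume U: "open U" "U \<noteq> {}" "e > 0"
    then obtain x where x: "isCont f x" "x \<in> U"
      using dense[of U] unfolding cont_points_def by blast
    obtain J where "open J" "x \<in> J" "\<And>y z. y \<in> J \<Longrightarrow> z \<in> J \<Longrightarrow> \<bar>f y - f z\<bar> \<le> e"
      using isCont_small_oscillation[OF x(1) U(3)] by metis
    with x show "\<exists>J. open J \<and> J \<inter> U \<noteq> {} \<and> (\<forall>y\<in>J \<inter> UNIV. \<forall>z\<in>J \<inter> UNIV. \<bar>f y - f z\<bar> \<le> e)" by blast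
  qed (rule that)
  have "isCont f x" if xG: "x \<in> G" for x
    unfolding continuous_at_open
  proof (intro allI impI)
    fix V assume "open V \<and> f x \<in> V"
    then obtain e where e: "e > 0" "ball (f x) e \<subseteq> V" by (meson open_contains_ball)
    obtain J where J: "open J" "x \<in> J" "\<forall>y\<in>J. \<forall>z\<in>J. \<bar>f y - f z\<bar> < e"
      using G(2)[OF xG e(1)] by auto
    then have "\<forall>y\<in>J. f y \<in> V" using e(2) by (auto simp: dist_real_def subset_iff)
    with J show "\<exists>S. open S \<and> x \<in> S \<and> (\<forall>y\<in>S. f y \<in> V)" by blast
  qed
  then show ?thesis using G(1) residual_superset by (auto simp: cont_points_def subset_iff)
qed

section \<open>Limits of Swiatkowski functions\<close>

text \<open>A category version of Egorov's theorem.\<close>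

lemma residual_limit_locally_uniform:
  fixes g :: "nat \<Rightarrow> real \<Rightarrow> real"
  assumes lim: "\<And>x. (\<lambda>n. g n x) \<longlonglongrightarrow> f x"
    and B: "residual B" "\<And>n. B \<subseteq> cont_points (g n)"
    and U: "open U" "U \<noteq> {}" and e: "e > 0"
  obtains J N where "open J" "J \<noteq> {}" "J \<subseteq> U"
    "\<And>x k. x \<in> J \<inter> B \<Longrightarrow> k \<ge> N \<Longrightarrow> \<bar>g k x - f x\<bar> \<le> e"
proof -
  \<comment> \<open>\<open>T N\<close> compares the \<open>g j\<close> with one another and not with
    \<open>f\<close>: continuity of the \<open>g j\<close> carries the bound from \<open>T N\<close>
    to every point of \<open>B\<close> in its closure. Letting \<open>j\<close> tend to infinity
    afterwards brings \<open>f\<close> back.\<close>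
  define T where "T N = {x \<in> B \<inter> U. \<forall>j\<ge>N. \<forall>k\<ge>N. \<bar>g j x - g k x\<bar> \<le> e}" for N
  have "\<exists>N. x \<in> T N" if "x \<in> B \<inter> U" for x
  proof -
    have "Cauchy (\<lambda>n. g n x)" using lim LIMSEQ_imp_Cauchy by blast
    then obtain N where "\<forall>m\<ge>N. \<forall>n\<ge>N. dist (g m x) (g n x) < e"
      using e unfolding Cauchy_def by blast
    then show ?thesis using that by (auto simp: T_def dist_real_def intro!: exI[of _ N] less_imp_le)
  qed
  then have cover: "B \<inter> U \<subseteq> (\<Union>N. T N)" by blast
  have "\<exists>N. \<not> nowhere_dense (T N)"
  proof (rule ccontr)
    assume "\<not> ?thesis"
    then have "meager (\<Union>N. T N)"
      unfolding meager_def by (intro exI[of _ "range T"]) auto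
    then have "residual (- (\<Union>N. T N))" by (simp add: residual_def)
    then have "residual (B \<inter> - (\<Union>N. T N))" using B(1) residual_Int by blast
    with residual_inter_open[OF _ U] cover show False by blast
  qed
  then obtain N where N: "interior (closure (T N)) \<noteq> {}" by (auto simp: nowhere_dense_def)
  define J where "J = interior (closure (T N)) \<inter> U"
  have near: "T N \<inter> V \<noteq> {}" if "open V" "x \<in> V" "x \<in> closure (T N)" for x V
    using that open_Int_closure_eq_empty[of V "T N"] by blast
  have "J \<noteq> {}"
    using near[of "interior (closure (T N))"] N interior_subset
    unfolding J_def T_def by blast
  moreover have "open J" "J \<subseteq> U" by (auto simp: J_def U)
  moreover have "\<bar>g k x - f x\<bar> \<le> e" if x: "x \<in> J \<inter> B" and k: "k \<ge> N" for x k
  proof -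
    have cl: "x \<in> closure (T N)" using x interior_subset unfolding J_def by blast
    have "\<bar>g k x - g j x\<bar> \<le> e" if j: "j \<ge> N" for j
    proof (rule ccontr)
      define \<phi> where "\<phi> y = \<bar>g k y - g j y\<bar>" for y
      assume "\<not> ?thesis"
      then have "\<phi> x \<in> {e<..}" by (simp add: \<phi>_def)
      moreover have "isCont (g k) x" "isCont (g j) x"
        using x B(2) by (auto simp: cont_points_def)
      then have "isCont \<phi> x" unfolding \<phi>_def by (intro continuous_intros)
      ultimately obtain V where V: "open V" "x \<in> V" "\<forall>y\<in>V. \<phi> y \<in> {e<..}"
        unfolding continuous_at_open by (metis open_greaterThan)
      then obtain y where "y \<in> T N" "y \<in> V" using near cl by blast
      then show False using V(3) j k by (fastforce simp: T_def \<phi>_def)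
    qed
    moreover have "(\<lambda>j. \<bar>g k x - g j x\<bar>) \<longlonglongrightarrow> \<bar>g k x - f x\<bar>"
      by (intro tendsto_intros lim)
    ultimately show ?thesis by (intro LIMSEQ_le_const2) auto
  qed
  ultimately show ?thesis using that by blast
qed

lemma swiatkowski_limit_in_frakS:
  fixes g :: "nat \<Rightarrow> real \<Rightarrow> real"
  assumes sw: "\<And>n. swiatkowski (g n)" and lim: "\<And>x. (\<lambda>n. g n x) \<longlonglongrightarrow> f x"
  shows "f \<in> frakS"
proof -
  define B where "B = (\<Inter>n. cont_points (g n))"
  have B: "residual B" "\<And>n. B \<subseteq> cont_points (g n)"
    unfolding B_def using residual_INF[OF swiatkowski_residual_cont_points[OF sw]] by auto
  obtain G where G: "residual G" "continuous_on (G \<inter> B) f"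
  proof (rule residual_small_oscillation[of B f])
    fix U :: "real set" and e :: real assume U: "open U" "U \<noteq> {}" and e: "e > 0"
    have e3: "e / 3 > 0" using e by simp
    obtain J N where J: "open J" "J \<noteq> {}" "J \<subseteq> U"
        "\<And>x k. x \<in> J \<inter> B \<Longrightarrow> k \<ge> N \<Longrightarrow> \<bar>g k x - f x\<bar> \<le> e / 3"
      using residual_limit_locally_uniform[OF lim B U e3] by blast
    obtain x where x: "x \<in> B" "x \<in> J" using residual_inter_open[OF B(1) J(1,2)] by blast
    then have "isCont (g N) x" using B(2) by (auto simp: cont_points_def)
    then obtain K where K: "open K" "x \<in> K"
        "\<And>y z. y \<in> K \<Longrightarrow> z \<in> K \<Longrightarrow> \<bar>g N y - g N z\<bar> \<le> e / 3"
      using isCont_small_oscillation[OF _ e3] by metis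
    have "\<bar>f y - f z\<bar> \<le> e" if "y \<in> J \<inter> K \<inter> B" "z \<in> J \<inter> K \<inter> B" for y z
    proof -
      have "\<bar>g N y - f y\<bar> \<le> e / 3" "\<bar>g N z - f z\<bar> \<le> e / 3" "\<bar>g N y - g N z\<bar> \<le> e / 3"
        using J(4)[of y N] J(4)[of z N] K(3)[of y z] that by auto
      then show ?thesis by linarith
    qed
    then show "\<exists>J. open J \<and> J \<inter> U \<noteq> {} \<and> (\<forall>y\<in>J \<inter> B. \<forall>z\<in>J \<inter> B. \<bar>f y - f z\<bar> \<le> e)"
      using J K x by (intro exI[of _ "J \<inter> K"]) auto
  qed (rule that)
  then have "has_baire_property f"
    using has_baire_property_iff_continuous_on_residual residual_Int[OF G(1) B(1)] by metis
  moreover have "S_cond f A e" if A: "residual A" and e: "e > 0" for A e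
    unfolding S_cond_def closure_eq_UNIV_iff
  proof (intro allI impI)
    fix U :: "real set" assume "open U \<and> U \<noteq> {}"
    then have U: "open U" "U \<noteq> {}" by auto
    have e2: "e / 2 > 0" using e by simp
    obtain J N where J: "open J" "J \<noteq> {}" "J \<subseteq> U"
        "\<And>x k. x \<in> J \<inter> B \<Longrightarrow> k \<ge> N \<Longrightarrow> \<bar>g k x - f x\<bar> \<le> e / 2"
      using residual_limit_locally_uniform[OF lim B U e2] by blast
    obtain x where x: "x \<in> J" using J(2) by blast
    obtain c d where cd: "c < x" "x < d" "{c..d} \<subseteq> J"
      using open_contains_interval[OF J(1) x] by blast
    have "S_on f {c<..<d} A e"
      unfolding S_on_def
    proof (intro ballI impI)
      fix a b assume ab: "a \<in> {c<..<d}" "b \<in> {c<..<d}" "f a < f b"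
      \<comment> \<open>The bound \<open>(f b - f a) / 2\<close> preserves the order of the two
        values under \<open>g k\<close>. The bound \<open>e / 2\<close> leaves the other half of
        \<open>e\<close> for the distance between \<open>g k\<close> and \<open>f\<close> at the
        point finally chosen in \<open>A \<inter> B\<close>.\<close>
      define r where "r = min (e / 2) ((f b - f a) / 2)"
      have r: "r > 0" "r \<le> e / 2" "2 * r \<le> f b - f a" using ab e by (auto simp: r_def min_def)
      have "\<forall>\<^sub>F k in sequentially. dist (g k a) (f a) < r \<and> dist (g k b) (f b) < r \<and> k \<ge> N"
        using r(1) lim by (intro eventually_conj tendstoD eventually_ge_at_top)
      then obtain k where k: "dist (g k a) (f a) < r" "dist (g k b) (f b) < r" "k \<ge> N"
        by (auto dest: eventually_happens)
      have gab: "g k a < g k b" "f a - e / 2 < g k a" "g k b < f b + e / 2"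
        using k r unfolding dist_real_def by linarith+
      have "\<exists>z\<in>oint a b. isCont (g k) z \<and> g k a < g k z \<and> g k z < g k b"
      proof (cases a b rule: linorder_cases)
        case less
        then have "\<exists>z\<in>{a<..<b} \<inter> cont_points (g k). min (g k a) (g k b) < g k z \<and> g k z < max (g k a) (g k b)"
          using gab(1) by (intro sw[of k, unfolded swiatkowski_def, rule_format]) auto
        then show ?thesis
          using gab(1) less by (auto simp: oint_def cont_points_def)
      next
        case greater
        then have "\<exists>z\<in>{b<..<a} \<inter> cont_points (g k). min (g k b) (g k a) < g k z \<and> g k z < max (g k b) (g k a)"
          using gab(1) by (intro sw[of k, unfolded swiatkowski_def, rule_format]) auto
        then show ?thesis
          using gab(1) greater by (auto simp: oint_def cont_points_def)
      qed (use gab in simp)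
      then obtain z where z: "z \<in> oint a b" "isCont (g k) z" "g k z \<in> {g k a<..<g k b}"
        by auto
      obtain V where V: "open V" "z \<in> V" "\<forall>y\<in>V. g k y \<in> {g k a<..<g k b}"
        using z(2)[unfolded continuous_at_open, rule_format, of "{g k a<..<g k b}"] z(3)
        by (auto simp del: greaterThanLessThan_iff)
      have "open (V \<inter> oint a b)" "V \<inter> oint a b \<noteq> {}"
        using V z by (auto simp: oint_def)
      then obtain y where y: "y \<in> A \<inter> B" "y \<in> V" "y \<in> oint a b"
        using residual_inter_open[OF residual_Int[OF A B(1)]] by blast
      have "y \<in> {c..d}" using y(3) ab by (auto simp: oint_def min_def max_def split: if_splits)
      then have "y \<in> J" using cd by blast
      then have "\<bar>g k y - f y\<bar> \<le> e / 2" using J(4) y k by blast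
      moreover have "g k a < g k y" "g k y < g k b" using V y by auto
      ultimately have "f a - e < f y \<and> f y < f b + e" using gab by linarith
      then show "\<exists>x\<in>A \<inter> oint a b. f a - e < f x \<and> f x < f b + e" using y by blast
    qed
    then have "x \<in> \<Union>{J. (\<exists>c d. c < d \<and> J = {c<..<d}) \<and> S_on f J A e}"
      using cd by (intro UnionI[of "{c<..<d}"] CollectI conjI exI[of _ c] exI[of _ d]) auto
    then show "\<Union>{J. (\<exists>c d. c < d \<and> J = {c<..<d}) \<and> S_on f J A e} \<inter> U \<noteq> {}"
      using x J(3) by blast
  qed
  ultimately show ?thesis by (simp add: frakS_def)
qed

section \<open>Gluing functions oscillating on disjoint intervals\<close>

lemma mult_sin_surj_greaterThan: "(\<lambda>t. t * sin t) ` {T<..} = (UNIV :: real set)"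
proof -
  have "y \<in> (\<lambda>t. t * sin t) ` {T<..}" for y
  proof -
    \<comment> \<open>At the points \<open>u\<close> and \<open>v\<close> below,
      \<open>t * sin t\<close> equals \<open>u\<close> and \<open>- v\<close>. Both lie beyond
      \<open>T\<close> and exceed \<open>\<bar>y\<bar>\<close>, so the intermediate value theorem
      applies.\<close>
    obtain n :: nat where n: "max T \<bar>y\<bar> < real n" using reals_Archimedean2 by blast
    define u where "u = 2 * real n * pi + pi / 2"
    define v where "v = 2 * real n * pi + 3 / 2 * pi"
    have "real n * 1 \<le> real n * (2 * pi)"
      using pi_ge_two by (intro mult_left_mono) auto
    then have "real n \<le> 2 * real n * pi" by simp
    then have uv: "max T \<bar>y\<bar> < u" "u \<le> v"
      using n pi_gt_zero unfolding u_def v_def by linarith+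
    have sin: "sin u = 1" "sin v = -1"
      unfolding u_def v_def sin_add sin_2npi cos_2npi sin_3over2_pi sin_pi_half by simp_all
    have "\<exists>t\<ge>u. t \<le> v \<and> t * sin t = y"
      using uv sin by (intro IVT2') (auto intro!: continuous_intros)
    then show ?thesis using uv by force
  qed
  then show ?thesis by blast
qed

text \<open>The auxiliary \<open>\<theta>\<close> tends to infinity at both ends, and
  \<open>t * sin t\<close> takes every real value beyond any bound. Composing with a continuous
  surjection \<open>\<tau>\<close> from the line onto \<open>V\<close> makes every one-sided
  neighbourhood of an end map onto \<open>V\<close>.\<close>

lemma exists_oscillating_function:
  fixes p q :: real
  assumes "p < q" and V: "V = UNIV \<or> (\<exists>c r. r > 0 \<and> V = ball c r)"
  obtains \<psi> :: "real \<Rightarrow> real" where "continuous_on {p<..<q} \<psi>" "\<And>x. \<psi> x \<in> V"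
    "\<And>x. x \<in> {p<..<q} \<Longrightarrow> \<psi> ` {p<..<x} = V" "\<And>x. x \<in> {p<..<q} \<Longrightarrow> \<psi> ` {x<..<q} = V"
proof -
  define \<theta> where "\<theta> x = max (1 / (x - p)) (1 / (q - x))" for x
  \<comment> \<open>This is the value of \<open>\<theta>\<close> at the midpoint. A larger value
    \<open>t\<close> is attained within \<open>1 / t\<close> of either end, where the term of the
    nearer end is the maximum.\<close>
  define m where "m = 2 / (q - p)"
  have right: "{max m (1 / (q - x))<..} \<subseteq> \<theta> ` {x<..<q}" if x: "x \<in> {p<..<q}" for x
  proof
    fix t assume t: "t \<in> {max m (1 / (q - x))<..}"
    have pos: "q - p > 0" "q - x > 0" using x by auto
    have "t > 0" using t pos by (auto simp: m_def intro: less_trans[of 0 "2 / (q - p)"])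
    define u where "u = q - 1 / t"
    have "1 / t < (q - p) / 2" "1 / t < q - x"
      using t pos \<open>t > 0\<close> by (auto simp: m_def field_simps)
    then have u: "x < u" "q - u < u - p" by (auto simp: u_def field_simps)
    have "u < q" "1 / (q - u) = t" using \<open>t > 0\<close> by (auto simp: u_def)
    moreover from this have "1 / (u - p) \<le> 1 / (q - u)" using u x by (intro divide_left_mono) auto
    ultimately have "\<theta> u = t" by (simp add: \<theta>_def)
    then show "t \<in> \<theta> ` {x<..<q}" using u \<open>u < q\<close> by (intro image_eqI[of _ _ u]) auto
  qed
  have left: "{max m (1 / (x - p))<..} \<subseteq> \<theta> ` {p<..<x}" if x: "x \<in> {p<..<q}" for x
  proof
    fix t assume t: "t \<in> {max m (1 / (x - p))<..}"
    have pos: "q - p > 0" "x - p > 0" using x by auto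
    have "t > 0" using t pos by (auto simp: m_def intro: less_trans[of 0 "2 / (q - p)"])
    define u where "u = p + 1 / t"
    have "1 / t < (q - p) / 2" "1 / t < x - p"
      using t pos \<open>t > 0\<close> by (auto simp: m_def field_simps)
    then have u: "u < x" "u - p < q - u" by (auto simp: u_def field_simps)
    have "p < u" "1 / (u - p) = t" using \<open>t > 0\<close> by (auto simp: u_def)
    moreover from this have "1 / (q - u) \<le> 1 / (u - p)" using u x by (intro divide_left_mono) auto
    ultimately have "\<theta> u = t" by (simp add: \<theta>_def)
    then show "t \<in> \<theta> ` {p<..<x}" using u \<open>p < u\<close> by (intro image_eqI[of _ _ u]) auto
  qed
  obtain \<tau> :: "real \<Rightarrow> real" where \<tau>: "continuous_on UNIV \<tau>" "range \<tau> = V"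
  proof (cases "V = UNIV")
    case True
    then show ?thesis using that[of "\<lambda>x. x"] by auto
  next
    case False
    then obtain c r where cr: "r > 0" "V = ball c r" using V by blast
    \<comment> \<open>\<open>y / (1 + \<bar>y\<bar>)\<close> maps the line onto the interval from -1
      to 1, with inverse \<open>w / (1 - \<bar>w\<bar>)\<close>.\<close>
    let ?\<tau> = "\<lambda>y. c + r * (y / (1 + \<bar>y\<bar>))"
    have "continuous_on UNIV ?\<tau>" by (intro continuous_intros) (auto simp: add_nonneg_eq_0_iff)
    moreover have "range ?\<tau> = V"
    proof (intro equalityI subsetI)
      fix v assume "v \<in> range ?\<tau>"
      then obtain y where y: "v = c + r * (y / (1 + \<bar>y\<bar>))" by blast
      have "\<bar>y\<bar> / (1 + \<bar>y\<bar>) < 1" by (simp add: divide_less_eq)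
      then have "r * (\<bar>y\<bar> / (1 + \<bar>y\<bar>)) < r * 1" using cr by (intro mult_strict_left_mono)
      moreover have "\<bar>c - v\<bar> = r * (\<bar>y\<bar> / (1 + \<bar>y\<bar>))"
        using cr by (simp add: y abs_mult abs_divide)
      ultimately show "v \<in> V" by (simp add: cr dist_real_def)
    next
      fix v assume "v \<in> V"
      define w where "w = (v - c) / r"
      have "\<bar>v - c\<bar> < r" using \<open>v \<in> V\<close> by (simp add: cr dist_real_def abs_minus_commute)
      then have w: "\<bar>w\<bar> < 1" using cr by (simp add: w_def abs_divide)
      define y where "y = w / (1 - \<bar>w\<bar>)"
      have "1 + \<bar>y\<bar> = 1 / (1 - \<bar>w\<bar>)" using w by (simp add: y_def abs_divide field_simps)
      then have y: "y / (1 + \<bar>y\<bar>) = w" using w by (simp add: y_def)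
      have "v = c + r * w" using cr by (simp add: w_def)
      then have "v = ?\<tau> y" by (simp only: y)
      then show "v \<in> range ?\<tau>" by (rule range_eqI)
    qed
    ultimately show ?thesis using that by blast
  qed
  define \<psi> where "\<psi> x = \<tau> (\<theta> x * sin (\<theta> x))" for x
  have in_V: "\<psi> x \<in> V" for x using \<tau>(2) by (auto simp: \<psi>_def)
  have surj: "\<psi> ` S = V" if "{T<..} \<subseteq> \<theta> ` S" for S T
  proof
    show "\<psi> ` S \<subseteq> V" using in_V by blast
    have "V = \<tau> ` (\<lambda>t. t * sin t) ` {T<..}"
      using \<tau>(2) by (simp add: mult_sin_surj_greaterThan)
    also have "\<dots> \<subseteq> \<tau> ` (\<lambda>t. t * sin t) ` \<theta> ` S" using that by (intro image_mono)
    also have "\<dots> = \<psi> ` S" by (simp add: image_image \<psi>_def)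
    finally show "V \<subseteq> \<psi> ` S" .
  qed
  show ?thesis
  proof
    have "continuous_on {p<..<q} \<theta>" unfolding \<theta>_def by (intro continuous_intros) auto
    then show "continuous_on {p<..<q} \<psi>"
      unfolding \<psi>_def by (intro continuous_on_compose2[OF \<tau>(1)] continuous_intros) auto
  qed (use in_V surj[OF left] surj[OF right] in auto)
qed

text \<open>Inside an interval of \<open>\<C>\<close> the values near either end already fill \<open>V I\<close>, so only pairs
  of points outside \<open>\<Union>\<C>\<close> have to be examined.\<close>

lemma swiatkowski_if_oscillating:
  assumes interval: "\<And>I. I \<in> \<C> \<Longrightarrow> \<exists>c d. c < d \<and> I = {c<..<d}"
    and V: "\<And>I. I \<in> \<C> \<Longrightarrow> open (V I)"
    and cont: "\<And>I. I \<in> \<C> \<Longrightarrow> continuous_on I g"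
    and left: "\<And>I x. I \<in> \<C> \<Longrightarrow> x \<in> I \<Longrightarrow> g ` (I \<inter> {..<x}) = V I"
    and right: "\<And>I x. I \<in> \<C> \<Longrightarrow> x \<in> I \<Longrightarrow> g ` (I \<inter> {x<..}) = V I"
    and outside: "\<And>a b. a < b \<Longrightarrow> a \<notin> \<Union>\<C> \<Longrightarrow> b \<notin> \<Union>\<C> \<Longrightarrow> g a \<noteq> g b \<Longrightarrow>
      \<exists>I\<in>\<C>. I \<subseteq> {a<..<b} \<and> V I \<inter> oint (g a) (g b) \<noteq> {}"
  shows "swiatkowski g"
proof -
  have isCont: "x \<in> cont_points g" if "x \<in> I" "I \<in> \<C>" for x I
  proof -
    have "open I" using interval[OF that(2)] by auto
    then show ?thesis
      using cont[OF that(2)] that(1) by (simp add: cont_points_def continuous_on_eq_continuous_at)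
  qed
  have in_V: "g x \<in> V I" if x: "x \<in> I" and I: "I \<in> \<C>" for x I
  proof -
    obtain c d where cd: "I = {c<..<d}" using interval[OF I] by blast
    then obtain y where "x < y" "y \<in> I" using x dense[of x d] by auto
    then show ?thesis using left[OF I, of y] x by blast
  qed
  have meets: "W \<inter> oint u v \<noteq> {}" if W: "open W" and uv: "u \<in> W \<or> v \<in> W" "u \<noteq> v"
    for W and u v :: real
  proof -
    have "u \<in> closure (oint u v)" "v \<in> closure (oint u v)"
      using uv(2) by (auto simp: oint_def min_def max_def)
    then show ?thesis using uv(1) open_Int_closure_eq_empty[OF W, of "oint u v"] by blast
  qed
  have "\<exists>x\<in>{a<..<b} \<inter> \<Union>\<C>. g x \<in> oint (g a) (g b)" if ab: "a < b" "g a \<noteq> g b" for a b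
  proof (cases "a \<in> \<Union>\<C> \<or> b \<in> \<Union>\<C>")
    case False
    then obtain I v where I: "I \<in> \<C>" "I \<subseteq> {a<..<b}" and v: "v \<in> V I" "v \<in> oint (g a) (g b)"
      using outside[OF ab(1) _ _ ab(2)] by blast
    obtain c d where cd: "c < d" "I = {c<..<d}" using interval[OF I(1)] by blast
    then obtain x where x: "x \<in> I" using dense[of c d] by auto
    have "v \<in> g ` (I \<inter> {x<..})" using right[OF I(1) x] v(1) by simp
    then obtain y where "y \<in> I" "g y = v" by blast
    then show ?thesis using I v by blast
  next
    case True
    then obtain I where I: "I \<in> \<C>" "a \<in> I \<or> b \<in> I" by blast
    then obtain c d where cd: "I = {c<..<d}" using interval by blast
    show ?thesis
    proof (cases "a \<in> I \<and> b \<in> I")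
      case True
      then have sub: "{a..b} \<subseteq> I" by (auto simp: cd)
      obtain v where v: "v \<in> oint (g a) (g b)"
        using meets[of UNIV "g a" "g b"] ab(2) by auto
      have conn: "connected (g ` {a..b})"
        using continuous_on_subset[OF cont[OF I(1)] sub] by (intro connected_continuous_image) auto
      have ends: "g a \<in> g ` {a..b}" "g b \<in> g ` {a..b}" using ab by auto
      have "v \<in> {g a..g b} \<or> v \<in> {g b..g a}"
        using v unfolding oint_def by auto
      then have "v \<in> g ` {a..b}"
        using connected_contains_Icc[OF conn ends] connected_contains_Icc[OF conn ends(2,1)] by blast
      then obtain x where x: "x \<in> {a..b}" "g x = v" by blast
      with v have "x \<noteq> a" "x \<noteq> b" by (auto simp: oint_def)
      with x have "x \<in> {a<..<b}" by auto
      moreover have "x \<in> \<Union>\<C>" using x(1) sub I(1) by blast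
      ultimately show ?thesis using x(2) v by blast
    next
      case False
      \<comment> \<open>Only one of the two points lies in \<open>I\<close>. The open set
        \<open>V I\<close> contains its value and hence values strictly between \<open>g a\<close>
        and \<open>g b\<close>. The part of \<open>I\<close> on the side of the other point stays
        between \<open>a\<close> and \<open>b\<close>, and its values fill
        \<open>V I\<close>.\<close>
      have "V I \<inter> oint (g a) (g b) \<noteq> {}"
        using I in_V V ab(2) by (intro meets) auto
      then obtain v where v: "v \<in> V I" "v \<in> oint (g a) (g b)" by blast
      have "\<exists>x\<in>{a<..<b} \<inter> I. g x = v"
      proof (cases "a \<in> I")
        case True
        then have "I \<inter> {a<..} \<subseteq> {a<..<b}" using False ab by (auto simp: cd)
        moreover have "v \<in> g ` (I \<inter> {a<..})" using right[OF I(1) True] v(1) by simp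
        ultimately show ?thesis by blast
      next
        case False
        then have b: "b \<in> I" using I by blast
        then have "I \<inter> {..<b} \<subseteq> {a<..<b}" using False ab by (auto simp: cd)
        moreover have "v \<in> g ` (I \<inter> {..<b})" using left[OF I(1) b] v(1) by simp
        ultimately show ?thesis by blast
      qed
      then show ?thesis using v I(1) by blast
    qed
  qed
  then have "\<exists>x\<in>{a<..<b} \<inter> cont_points g. g x \<in> oint (g a) (g b)" if "a < b" "g a \<noteq> g b" for a b
    using that isCont by blast
  then show ?thesis
    unfolding swiatkowski_def oint_def greaterThanLessThan_iff by blast
qed

section \<open>Nested families of intervals\<close>

text \<open>A member meeting \<open>T\<close> and the union of the other members are disjoint open
  sets covering \<open>T\<close>. This later places an interval that misses the complement of a
  family inside a single cell of it.\<close>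

lemma connected_subset_member:
  assumes "\<And>I. I \<in> \<C> \<Longrightarrow> open I" "pairwise disjnt \<C>" "connected T" "T \<subseteq> \<Union>\<C>" "T \<noteq> {}"
  obtains I where "I \<in> \<C>" "T \<subseteq> I"
proof -
  obtain x I where x: "x \<in> T" "x \<in> I" "I \<in> \<C>" using assms(4,5) by blast
  have "I \<inter> \<Union>(\<C> - {I}) = {}"
    using assms(2) x(3) by (fastforce simp: pairwise_def disjnt_def)
  then have "I \<inter> T = {} \<or> \<Union>(\<C> - {I}) \<inter> T = {}"
    using assms(1,4) x(3) by (intro connectedD[OF assms(3)]) auto
  then have "T \<subseteq> I" using x assms(4) by blast
  with x that show ?thesis by blast
qed

text \<open>By Zorn's lemma take a maximal disjoint family; if its union missed an open set, a
  member inside that set could be added. Non-emptiness of \<open>I\<close> guarantees that the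
  addition is new.\<close>

lemma exists_dense_disjoint_family:
  fixes P :: "'a::topological_space set \<Rightarrow> bool"
  assumes P: "\<And>U. open U \<Longrightarrow> U \<noteq> {} \<Longrightarrow> \<exists>I. P I \<and> I \<noteq> {} \<and> I \<subseteq> U"
  obtains \<C> where "\<And>I. I \<in> \<C> \<Longrightarrow> P I" "pairwise disjnt \<C>" "closure (\<Union>\<C>) = UNIV"
proof -
  define \<A> where "\<A> = {\<C>. (\<forall>I\<in>\<C>. P I) \<and> pairwise disjnt \<C>}"
  have "\<exists>\<C>\<in>\<A>. \<forall>X\<in>\<A>. \<C> \<subseteq> X \<longrightarrow> X = \<C>"
  proof (rule subset_Zorn')
    fix C assume C: "subset.chain \<A> C"
    have "pairwise disjnt (\<Union>C)"
    proof (rule pairwiseI)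
      fix I J assume "I \<in> \<Union>C" "J \<in> \<Union>C" "I \<noteq> J"
      then obtain X Y where XY: "I \<in> X" "X \<in> C" "J \<in> Y" "Y \<in> C" by blast
      then have "X \<subseteq> Y \<or> Y \<subseteq> X" "X \<in> \<A>" "Y \<in> \<A>"
        using C unfolding subset_chain_def by blast+
      then obtain Z where Z: "Z \<in> \<A>" "I \<in> Z" "J \<in> Z" using XY by blast
      then have "pairwise disjnt Z" by (simp add: \<A>_def)
      then show "disjnt I J" using Z(2,3) \<open>I \<noteq> J\<close> by (rule pairwiseD)
    qed
    then show "\<Union>C \<in> \<A>" using C unfolding \<A>_def subset_chain_def by blast
  qed
  then obtain \<C> where \<C>: "\<C> \<in> \<A>" "\<And>X. X \<in> \<A> \<Longrightarrow> \<C> \<subseteq> X \<Longrightarrow> X = \<C>" by blast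
  have "closure (\<Union>\<C>) = UNIV"
    unfolding closure_eq_UNIV_iff
  proof (intro allI impI notI)
    fix U :: "'a set" assume U: "open U \<and> U \<noteq> {}" and disj: "\<Union>\<C> \<inter> U = {}"
    obtain I where I: "P I" "I \<noteq> {}" "I \<subseteq> U" using P U by blast
    have "disjnt I J" "disjnt J I" if "J \<in> \<C>" for J
      using I(3) disj that unfolding disjnt_def by blast+
    then have "insert I \<C> \<in> \<A>"
      using \<C>(1) I(1) by (simp add: \<A>_def pairwise_insert)
    then have "I \<in> \<C>" using \<C>(2)[of "insert I \<C>"] by blast
    then show False using I disj by blast
  qed
  with \<C>(1) that show ?thesis unfolding \<A>_def by blast
qed

text \<open>The condition S is taken with the same \<open>R\<close> as the oscillation bound, so
  that the points it supplies have values within \<open>e\<close> of all other values of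
  \<open>f\<close> along \<open>R\<close> in the interval.\<close>

definition good_interval :: "(real \<Rightarrow> real) \<Rightarrow> real set \<Rightarrow> real \<Rightarrow> real set \<Rightarrow> real set \<Rightarrow> real set \<Rightarrow> bool"
  where "good_interval f R e N M I \<longleftrightarrow>
    (\<exists>c d. c < d \<and> I = {c<..<d} \<and> {c..d} \<inter> M = {}) \<and> I \<inter> N = {} \<and>
    (\<forall>y\<in>I \<inter> R. \<forall>z\<in>I \<inter> R. \<bar>f y - f z\<bar> \<le> e) \<and> S_on f I R e"

lemma S_on_subset: "S_on f J A e \<Longrightarrow> I \<subseteq> J \<Longrightarrow> S_on f I A e"
  unfolding S_on_def by (meson subsetD)

text \<open>Requiring the closed interval to avoid \<open>M\<close> keeps every cell of the next family at a positive
  distance from \<open>M\<close>; avoiding \<open>N\<close> makes the points left over by all families belong to \<open>R\<close>.\<close>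

lemma exists_good_interval:
  assumes R: "residual R" "continuous_on R f" and S: "S_cond f R e" and e: "e > 0"
    and N: "nowhere_dense N" and M: "closed M" "interior M = {}" and U: "open U" "U \<noteq> {}"
  shows "\<exists>I. good_interval f R e N M I \<and> I \<noteq> {} \<and> I \<subseteq> U"
proof -
  \<comment> \<open>\<open>U\<close> is cut down in turn by the dense open sets \<open>- M\<close>
    and \<open>- closure N\<close>, by an interval with the condition S, and finally by a
    neighbourhood of a point of \<open>R\<close> that bounds the oscillation.\<close>
  have "closure (- M) = UNIV" using M(2) by (simp add: closure_complement)
  moreover have "open (- M)" using M(1) by auto
  ultimately have "- M \<inter> U \<noteq> {}" "open (- M \<inter> U)"
    using U closure_eq_UNIV_iff by blast+
  moreover have "closure (- closure N) = UNIV"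
    using N by (simp add: closure_complement nowhere_dense_def)
  ultimately have "- closure N \<inter> (- M \<inter> U) \<noteq> {}" "open (- closure N \<inter> (- M \<inter> U))"
    using closure_eq_UNIV_iff by blast+
  then have "\<Union>{J. (\<exists>c d. c < d \<and> J = {c<..<d}) \<and> S_on f J R e} \<inter> (- closure N \<inter> (- M \<inter> U)) \<noteq> {}"
    using S unfolding S_cond_def closure_eq_UNIV_iff by blast
  then obtain J where J: "\<exists>c d. c < d \<and> J = {c<..<d}" "S_on f J R e" "J \<inter> (- closure N \<inter> (- M \<inter> U)) \<noteq> {}"
    by blast
  define W where "W = J \<inter> (- closure N \<inter> (- M \<inter> U))"
  have W: "open W" "W \<noteq> {}"
    using J \<open>open (- closure N \<inter> (- M \<inter> U))\<close> unfolding W_def by auto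
  then obtain x where x: "x \<in> R" "x \<in> W" using residual_inter_open[OF R(1)] by blast
  obtain A where A: "open A" "A \<inter> R = f -` ball (f x) (e / 2) \<inter> R"
    using R(2) unfolding continuous_on_open_invariant by (metis open_ball)
  have "x \<in> A" using A(2) x e by auto
  then obtain c d where cd: "c < x" "x < d" "{c..d} \<subseteq> A \<inter> W"
    using open_contains_interval[of "A \<inter> W" x] A(1) W(1) x by blast
  have sub: "{c<..<d} \<subseteq> A \<inter> W" using cd(3) greaterThanLessThan_subseteq_atLeastAtMost_iff by blast
  have "\<bar>f y - f z\<bar> \<le> e" if "y \<in> {c<..<d} \<inter> R" "z \<in> {c<..<d} \<inter> R" for y z
  proof -
    have "y \<in> A \<inter> R" "z \<in> A \<inter> R" using that sub by blast+
    then have "dist (f x) (f y) < e / 2" "dist (f x) (f z) < e / 2" unfolding A(2) by auto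
    then show ?thesis unfolding dist_real_def by linarith
  qed
  moreover have "S_on f {c<..<d} R e"
    using sub by (intro S_on_subset[OF J(2)]) (auto simp: W_def)
  moreover have "{c<..<d} \<inter> N = {}" "{c..d} \<inter> M = {}"
    using sub cd(3) closure_subset[of N] unfolding W_def by blast+
  ultimately have "good_interval f R e N M {c<..<d}"
    unfolding good_interval_def using cd by (metis less_trans)
  moreover have "x \<in> {c<..<d}" "{c<..<d} \<subseteq> U" using cd sub unfolding W_def by auto
  ultimately show ?thesis by blast
qed

text \<open>Dependent choice. Stage 0 is the whole line, on which nothing can be demanded of
  \<open>f\<close>; hence only the stages \<open>Suc n\<close> consist of good intervals, and each
  of them avoids one further set \<open>N n\<close>.\<close>

lemma exists_nested_good_families:
  fixes N :: "nat \<Rightarrow> real set"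
  assumes R: "residual R" "continuous_on R f" and S: "\<And>e. e > 0 \<Longrightarrow> S_cond f R e"
    and N: "\<And>n. nowhere_dense (N n)" and e: "\<And>n. e n > 0"
  obtains \<C> :: "nat \<Rightarrow> real set set" where "\<C> 0 = {UNIV}"
    "\<And>n. pairwise disjnt (\<C> n)" "\<And>n. closure (\<Union>(\<C> n)) = UNIV"
    "\<And>n I. I \<in> \<C> (Suc n) \<Longrightarrow> good_interval f R (e (Suc n)) (N n) (- \<Union>(\<C> n)) I"
proof -
  let ?P = "\<lambda>(n::nat) \<C>. (n = 0 \<longrightarrow> \<C> = {UNIV :: real set}) \<and> (\<forall>I\<in>\<C>. open I) \<and>
    pairwise disjnt \<C> \<and> closure (\<Union>\<C>) = UNIV"
  let ?Q = "\<lambda>n \<C> \<D>. \<forall>I\<in>\<D>. good_interval f R (e (Suc n)) (N n) (- \<Union>\<C>) I"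
  have "\<exists>\<C>. \<forall>n. ?P n (\<C> n) \<and> ?Q n (\<C> n) (\<C> (Suc n))"
  proof (rule dependent_nat_choice)
    show "\<exists>\<C>. ?P 0 \<C>" by (rule exI[of _ "{UNIV}"]) simp
  next
    fix \<C> n assume \<C>: "?P n \<C>"
    have M: "closed (- \<Union>\<C>)" "interior (- \<Union>\<C>) = {}"
      using \<C> by (auto simp: interior_complement)
    obtain \<D> where \<D>: "\<And>I. I \<in> \<D> \<Longrightarrow> good_interval f R (e (Suc n)) (N n) (- \<Union>\<C>) I"
        "pairwise disjnt \<D>" "closure (\<Union>\<D>) = UNIV"
      using exists_dense_disjoint_family[OF exists_good_interval[OF R S[OF e] e N M]] by metis
    moreover have "open I" if "I \<in> \<D>" for I
      using \<D>(1)[OF that] by (auto simp: good_interval_def)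
    ultimately have "?P (Suc n) \<D> \<and> ?Q n \<C> \<D>" by simp
    then show "\<exists>\<D>. ?P (Suc n) \<D> \<and> ?Q n \<C> \<D>" by (rule exI)
  qed
  then obtain \<C> where "\<And>n. ?P n (\<C> n)" "\<And>n. ?Q n (\<C> n) (\<C> (Suc n))" by metis
  with that[of \<C>] show ?thesis by simp
qed

text \<open>This brings a value set given by finitely many amplitude bounds into the form that the
  oscillating functions require: without bounds it is the whole line, otherwise the smallest radius
  decides.\<close>

lemma Ball_abs_less_eq_ball:
  fixes c :: real
  assumes "finite K" "\<And>k. k \<in> K \<Longrightarrow> r k > 0"
  shows "{y. \<forall>k\<in>K. \<bar>y - c\<bar> < r k} = UNIV \<or> (\<exists>\<rho>>0. {y. \<forall>k\<in>K. \<bar>y - c\<bar> < r k} = ball c \<rho>)"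
proof (cases "K = {}")
  case False
  have "\<bar>y - c\<bar> < Min (r ` K) \<longleftrightarrow> (\<forall>k\<in>K. \<bar>y - c\<bar> < r k)" for y
    using assms(1) False by simp
  then have "{y. \<forall>k\<in>K. \<bar>y - c\<bar> < r k} = ball c (Min (r ` K))"
    by (simp add: ball_def dist_real_def abs_minus_commute)
  moreover have "Min (r ` K) > 0" using assms False by auto
  ultimately show ?thesis by blast
qed simp

section \<open>Construction of the approximating Swiatkowski functions\<close>

lemma frakS_swiatkowski_limit:
  assumes "f \<in> frakS"
  obtains g :: "nat \<Rightarrow> real \<Rightarrow> real" where "\<And>n. swiatkowski (g n)" "\<And>x. (\<lambda>n. g n x) \<longlonglongrightarrow> f x"
proof -
  obtain R where R: "residual R" "continuous_on R f"
    using assms has_baire_property_iff_continuous_on_residual unfolding frakS_def by blast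
  have S: "S_cond f R \<epsilon>" if "\<epsilon> > 0" for \<epsilon> using assms R(1) that by (auto simp: frakS_def)
  obtain F where F: "countable F" "\<forall>S\<in>F. nowhere_dense S" "- R \<subseteq> \<Union>F"
    using R(1) unfolding residual_def meager_def by blast
  \<comment> \<open>The empty set is nowhere dense; inserting it allows an enumeration even when
    \<open>F\<close> is empty.\<close>
  define N where "N = from_nat_into (insert {} F)"
  have rangeN: "range N = insert {} F"
    unfolding N_def using F(1) by (intro range_from_nat_into) auto
  have N: "nowhere_dense (N n)" for n
  proof -
    have "N n \<in> insert {} F" using rangeN by blast
    then show ?thesis using F(2) by (auto simp: nowhere_dense_def)
  qed
  have R_cover: "- R \<subseteq> (\<Union>n. N n)" using F(3) rangeN by auto
  define e where "e n = 1 / real (Suc n)" for n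
  have e: "e n > 0" for n by (simp add: e_def)
  have e_mono: "e n \<le> e m" if "m \<le> n" for m n using that by (simp add: e_def frac_le)
  obtain \<C> where \<C>: "\<C> 0 = {UNIV}" "\<And>n. pairwise disjnt (\<C> n)" "\<And>n. closure (\<Union>(\<C> n)) = UNIV"
      and good: "\<And>n I. I \<in> \<C> (Suc n) \<Longrightarrow> good_interval f R (e (Suc n)) (N n) (- \<Union>(\<C> n)) I"
    using exists_nested_good_families[of R f N e] R S N e by blast
  define M where "M n = - \<Union>(\<C> n)" for n
  have interval: "\<exists>c d. c < d \<and> I = {c<..<d}" if "I \<in> \<C> n" "n > 0" for I n
    using good[of I "n - 1"] that unfolding good_interval_def by auto
  have open_cell: "open I" if "I \<in> \<C> n" for I n
    using interval[of I n] that \<C>(1) by (cases "n = 0") auto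
  have conn_cell: "connected I" if "I \<in> \<C> n" for I n
    using interval[of I n] that \<C>(1) by (cases "n = 0") auto
  have M_Suc: "M n \<subseteq> M (Suc n)" for n
  proof -
    have "I \<inter> M n = {}" if "I \<in> \<C> (Suc n)" for I
    proof -
      obtain c d where "I = {c<..<d}" "{c..d} \<inter> M n = {}"
        using good[OF \<open>I \<in> \<C> (Suc n)\<close>] unfolding good_interval_def M_def by blast
      moreover have "{c<..<d} \<subseteq> {c..d}" by auto
      ultimately show ?thesis by blast
    qed
    then show ?thesis unfolding M_def by blast
  qed
  have M_mono: "M m \<subseteq> M n" if "m \<le> n" for m n
    using lift_Suc_mono_le[of M, OF M_Suc that] .
  have M_closed: "closed (M n)" for n unfolding M_def using open_cell by blast
  have member: "\<exists>I\<in>\<C> n. T \<subseteq> I" if "connected T" "T \<noteq> {}" "T \<subseteq> \<Union>(\<C> n)" for T n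
    using connected_subset_member[of "\<C> n" T] open_cell \<C>(2) that by metis
  define cell where "cell n x = (THE I. I \<in> \<C> n \<and> x \<in> I)" for n x
  have cell_eq: "cell n x = I" if "I \<in> \<C> n" "x \<in> I" for n x I
    unfolding cell_def
  proof (rule the_equality)
    show "J = I" if J: "J \<in> \<C> n \<and> x \<in> J" for J
    proof (rule ccontr)
      assume "J \<noteq> I"
      then have "disjnt J I" using \<C>(2)[of n] J \<open>I \<in> \<C> n\<close> by (auto simp: pairwise_def)
      then show False using J \<open>x \<in> I\<close> by (auto simp: disjnt_def)
    qed
  qed (use that in simp)
  define pt where "pt I = (SOME y. y \<in> I \<inter> R)" for I
  have pt: "pt I \<in> I \<inter> R" if "I \<in> \<C> n" "n > 0" for I n
  proof -
    have "I \<noteq> {}" using interval[OF that] by auto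
    then have "\<exists>y. y \<in> I \<inter> R" using residual_inter_open[OF R(1) open_cell[OF that(1)]] by blast
    then show ?thesis unfolding pt_def by (rule someI_ex)
  qed
  \<comment> \<open>If \<open>I\<close> comes close to \<open>M 1\<close>, then \<open>K n I\<close> is empty and \<open>V n I\<close> is the whole line: no amplitude
    bound can be afforded there, because \<open>f\<close> need not satisfy any global condition.\<close>
  define K where "K n I = {k\<in>{1..n}. \<forall>x\<in>I. \<forall>m\<in>M k. 1 / real n \<le> dist x m}" for n I
  define V where "V n I = {y. \<forall>k\<in>K n I. \<bar>y - f (pt I)\<bar> < 2 * e k}" for n I
  have V: "V n I = UNIV \<or> (\<exists>c r. r > 0 \<and> V n I = ball c r)" for n I
    using Ball_abs_less_eq_ball[of "K n I" "\<lambda>k. 2 * e k" "f (pt I)"] e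
    unfolding V_def by (auto simp: K_def)
  define osc where "osc n I \<psi> \<longleftrightarrow> continuous_on I \<psi> \<and> (\<forall>x. \<psi> x \<in> V n I) \<and>
      (\<forall>x\<in>I. \<psi> ` (I \<inter> {..<x}) = V n I \<and> \<psi> ` (I \<inter> {x<..}) = V n I)" for n I \<psi>
  have ex_osc: "\<exists>\<psi>. osc n I \<psi>" if "I \<in> \<C> n" "n > 0" for n I
  proof -
    from that obtain c d where cd: "c < d" "I = {c<..<d}" using interval by blast
    obtain \<psi> where \<psi>: "continuous_on {c<..<d} \<psi>" "\<And>x. \<psi> x \<in> V n I"
        "\<And>x. x \<in> {c<..<d} \<Longrightarrow> \<psi> ` {c<..<x} = V n I" "\<And>x. x \<in> {c<..<d} \<Longrightarrow> \<psi> ` {x<..<d} = V n I"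
      using exists_oscillating_function[OF cd(1) V] by metis
    have "I \<inter> {..<x} = {c<..<x}" "I \<inter> {x<..} = {x<..<d}" if "x \<in> I" for x
      using that by (auto simp: cd)
    with \<psi> have "osc n I \<psi>" unfolding osc_def cd(2) by auto
    then show ?thesis by blast
  qed
  define \<psi> where "\<psi> n I = (SOME \<psi>. osc n I \<psi>)" for n I
  have "osc n I (\<psi> n I)" if "I \<in> \<C> n" "n > 0" for n I
    unfolding \<psi>_def by (rule someI_ex[OF ex_osc[OF that]])
  then have \<psi>: "continuous_on I (\<psi> n I)" "\<psi> n I x \<in> V n I"
      "x \<in> I \<Longrightarrow> \<psi> n I ` (I \<inter> {..<x}) = V n I" "x \<in> I \<Longrightarrow> \<psi> n I ` (I \<inter> {x<..}) = V n I"
    if "I \<in> \<C> n" "n > 0" for n I x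
    using that unfolding osc_def by blast+
  define g where "g n x = (if x \<in> M n then f x else \<psi> n (cell n x) x)" for n x
  have g_cell: "g n x = \<psi> n I x" if "I \<in> \<C> n" "x \<in> I" for n x I
    using that cell_eq[OF that] by (auto simp: g_def M_def)
  have "swiatkowski (g n)" if n: "n > 0" for n
  proof (rule swiatkowski_if_oscillating[where \<C> = "\<C> n" and V = "V n"])
    fix I assume I: "I \<in> \<C> n"
    show "\<exists>c d. c < d \<and> I = {c<..<d}" using interval[OF I n] .
    show "open (V n I)" using V[of n I] by auto
    show "continuous_on I (g n)"
      using \<psi>(1)[OF I n] g_cell[OF I] by (simp cong: continuous_on_cong)
    fix x assume x: "x \<in> I"
    show "g n ` (I \<inter> {..<x}) = V n I"
      unfolding \<psi>(3)[OF I n x, symmetric] using g_cell[OF I] by (intro image_cong) auto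
    show "g n ` (I \<inter> {x<..}) = V n I"
      unfolding \<psi>(4)[OF I n x, symmetric] using g_cell[OF I] by (intro image_cong) auto
  next
    fix a b assume ab: "a < b" "a \<notin> \<Union>(\<C> n)" "b \<notin> \<Union>(\<C> n)" "g n a \<noteq> g n b"
    have g_ab: "g n a = f a" "g n b = f b" using ab by (auto simp: g_def M_def)
    \<comment> \<open>\<open>j\<close> is the first stage that separates \<open>a\<close> from
      \<open>b\<close> or has one of them in its complement. It is positive because
      \<open>M 0\<close> is empty, so at stage \<open>k = j - 1\<close> the whole of
      \<open>{a..b}\<close> still lies in one cell.\<close>
    define j where "j = (LEAST j. {a..b} \<inter> M j \<noteq> {})"
    have "a \<in> M n" using ab(2) by (simp add: M_def)
    moreover have "a \<in> {a..b}" using ab(1) by simp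
    ultimately have aM: "{a..b} \<inter> M n \<noteq> {}" by blast
    have j: "{a..b} \<inter> M j \<noteq> {}" "j \<le> n"
      unfolding j_def by (rule LeastI, rule aM) (rule Least_le, rule aM)
    have "j \<noteq> 0" using j(1) \<C>(1) by (auto simp: M_def intro: gr0I)
    then obtain k where k: "j = Suc k" using not0_implies_Suc by blast
    then have ab_k: "{a..b} \<inter> M k = {}" using not_less_Least[of k "\<lambda>j. {a..b} \<inter> M j \<noteq> {}"] j_def by auto
    obtain r where r: "r \<in> {a..b}" "r \<in> M (Suc k)" using j(1) k by blast
    \<comment> \<open>A cell \<open>I\<close> of stage \<open>n\<close> is sought that has a point
      closer than \<open>1 / real n\<close> to \<open>r\<close>. As \<open>r\<close> lies in
      \<open>M k'\<close> for all \<open>k' > k\<close>, no such \<open>k'\<close> belongs to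
      \<open>K n I\<close>, so the amplitude on \<open>I\<close> is not bounded more tightly than at
      stage \<open>k\<close>.\<close>
    have "r \<in> closure {a<..<b}" using r(1) ab(1) by simp
    moreover have "r \<in> ball r (1 / real n)" using n by simp
    ultimately have "ball r (1 / real n) \<inter> {a<..<b} \<noteq> {}"
      using open_Int_closure_eq_empty[OF open_ball, of r "1 / real n" "{a<..<b}"] by blast
    moreover have "open (ball r (1 / real n) \<inter> {a<..<b})" by (intro open_Int) auto
    ultimately have "\<Union>(\<C> n) \<inter> (ball r (1 / real n) \<inter> {a<..<b}) \<noteq> {}"
      using \<C>(3)[of n, unfolded closure_eq_UNIV_iff] by meson
    then obtain x I where x: "x \<in> ball r (1 / real n)" "x \<in> {a<..<b}" "x \<in> I" "I \<in> \<C> n" by blast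
    have "a \<notin> I" "b \<notin> I" using ab x(4) by blast+
    then have I: "I \<subseteq> {a<..<b}" using interval[OF x(4) n] x(2,3) by auto
    have K: "k' \<le> k" if "k' \<in> K n I" for k'
    proof (rule ccontr)
      assume "\<not> k' \<le> k"
      then have "r \<in> M k'" using M_mono[of "Suc k" k'] r(2) by auto
      then have "1 / real n \<le> dist x r" using that x(3) by (auto simp: K_def)
      then show False using x(1) by (simp add: dist_commute)
    qed
    have "V n I \<inter> oint (f a) (f b) \<noteq> {}"
    proof (cases "k = 0")
      case True
      \<comment> \<open>The indices in \<open>K n I\<close> start at 1, so none is at most 0 and no
        bound restricts the values on \<open>I\<close>.\<close>
      then have "V n I = UNIV" using K by (fastforce simp: V_def K_def)
      then show ?thesis using ab(4) unfolding g_ab by (auto simp: oint_def)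
    next
      case False
      then obtain k0 where k0: "k = Suc k0" using not0_implies_Suc by blast
      have "{a..b} \<subseteq> \<Union>(\<C> k)" using ab_k by (auto simp: M_def)
      then obtain J where J: "J \<in> \<C> k" "{a..b} \<subseteq> J"
        using member[of "{a..b}" k] ab(1) by auto
      have J_good: "\<forall>y\<in>J \<inter> R. \<forall>z\<in>J \<inter> R. \<bar>f y - f z\<bar> \<le> e k" "S_on f J R (e k)"
        using good[of J k0] J(1) unfolding k0 good_interval_def by blast+
      have ab_J: "a \<in> J" "b \<in> J" using J(2) ab(1) by auto
      define lo hi where "lo = min (f a) (f b)" and "hi = max (f a) (f b)"
      have "lo < hi" using ab(4) unfolding g_ab lo_def hi_def by auto
      have "\<exists>y\<in>R \<inter> {a<..<b}. lo - e k < f y \<and> f y < hi + e k"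
      proof (cases "f a < f b")
        case True
        then show ?thesis
          using J_good(2)[unfolded S_on_def, rule_format, OF ab_J True] ab(1)
          by (simp add: oint_def lo_def hi_def)
      next
        case False
        then have "f b < f a" using ab(4) g_ab by simp
        then show ?thesis
          using J_good(2)[unfolded S_on_def, rule_format, OF ab_J(2,1)] ab(1)
          by (simp add: oint_def lo_def hi_def)
      qed
      then obtain y where y: "y \<in> R" "y \<in> {a<..<b}" "lo - e k < f y" "f y < hi + e k" by blast
      have "{a<..<b} \<subseteq> J" using J(2) by auto
      then have "\<bar>f y - f (pt I)\<bar> \<le> e k"
        using J_good(1) y(1,2) pt[OF x(4) n] I by blast
      \<comment> \<open>This is the reason for the factor 2: one \<open>e k\<close> is the tolerance
        in the condition S for \<open>y\<close>, the other the oscillation between \<open>y\<close>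
        and \<open>pt I\<close>. Thus the interval of radius \<open>2 * e k\<close> about
        \<open>f (pt I)\<close> overlaps the one from \<open>lo\<close> to
        \<open>hi\<close>.\<close>
      then have "max lo (f (pt I) - 2 * e k) < min hi (f (pt I) + 2 * e k)"
        using y(3,4) \<open>lo < hi\<close> e[of k] by (auto simp: abs_le_iff)
      then obtain v where v: "max lo (f (pt I) - 2 * e k) < v" "v < min hi (f (pt I) + 2 * e k)"
        using dense by blast
      have "\<bar>v - f (pt I)\<bar> < 2 * e k'" if "k' \<in> K n I" for k'
        using v e_mono[OF K[OF that]] by (auto simp: abs_less_iff)
      then have "v \<in> V n I" by (simp add: V_def)
      moreover have "v \<in> oint (f a) (f b)" using v by (simp add: oint_def lo_def hi_def)
      ultimately show ?thesis by blast
    qed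
    then show "\<exists>I\<in>\<C> n. I \<subseteq> {a<..<b} \<and> V n I \<inter> oint (g n a) (g n b) \<noteq> {}"
      using x(4) I unfolding g_ab by blast
  qed
  moreover have "(\<lambda>n. g n x) \<longlonglongrightarrow> f x" for x
  proof (cases "\<exists>m. x \<in> M m")
    case True
    then obtain m where "x \<in> M m" by blast
    then have "\<forall>n\<ge>m. g n x = f x" using M_mono by (auto simp: g_def)
    then show ?thesis
      by (intro tendsto_eventually) (auto simp: eventually_sequentially)
  next
    case False
    then have ex: "\<exists>I\<in>\<C> n. x \<in> I" for n by (auto simp: M_def)
    have "x \<in> R"
    proof (rule ccontr)
      assume "x \<notin> R"
      then obtain n where "x \<in> N n" using R_cover by blast
      moreover obtain I where "I \<in> \<C> (Suc n)" "x \<in> I" using ex by blast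
      ultimately show False using good[of I n] unfolding good_interval_def by blast
    qed
    show ?thesis
    proof (rule tendstoI)
      fix \<epsilon> :: real assume "\<epsilon> > 0"
      \<comment> \<open>Of the three parts, two pay for the amplitude \<open>2 * e (Suc k)\<close>
        and one for the oscillation of \<open>f\<close> between \<open>pt I\<close> and
        \<open>x\<close>. The index is \<open>Suc k\<close> because amplitude bounds exist only from
        index 1 on.\<close>
      then obtain k where "1 / real (Suc k) < \<epsilon> / 3" using nat_approx_posE[of "\<epsilon> / 3"] by auto
      moreover have "e (Suc k) \<le> 1 / real (Suc k)" using e_mono[of k "Suc k"] by (simp add: e_def)
      ultimately have k: "3 * e (Suc k) < \<epsilon>" by linarith
      obtain J where J: "J \<in> \<C> (Suc (Suc k))" "x \<in> J" using ex by blast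
      obtain c d where cd: "J = {c<..<d}" "{c..d} \<inter> M (Suc k) = {}"
        using good[OF J(1)] unfolding good_interval_def M_def by blast
      have J_osc: "\<forall>y\<in>J \<inter> R. \<forall>z\<in>J \<inter> R. \<bar>f y - f z\<bar> \<le> e (Suc (Suc k))"
        using good[OF J(1)] unfolding good_interval_def by blast
      \<comment> \<open>The closed hull of \<open>J\<close> is compact and misses the closed set
        \<open>M (Suc k)\<close>, hence has positive distance from it. Once
        \<open>1 / real n\<close> is at most \<open>\<delta>\<close>, the cell of \<open>x\<close>
        at stage \<open>n\<close> is subject to the bound with index \<open>Suc k\<close>.\<close>
      obtain \<delta> where \<delta>: "\<delta> > 0" "\<forall>y\<in>{c..d}. \<forall>m\<in>M (Suc k). \<delta> \<le> dist y m"
        using separate_compact_closed[of "{c..d}" "M (Suc k)"] M_closed cd(2) by auto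
      obtain n0 where n0: "1 / real (Suc n0) < \<delta>" using nat_approx_posE[OF \<delta>(1)] by blast
      have "dist (g n x) (f x) < \<epsilon>" if n: "n \<ge> max (Suc (Suc k)) (Suc n0)" for n
      proof -
        have n_pos: "n > 0" using n by simp
        obtain I where I: "I \<in> \<C> n" "x \<in> I" using ex by blast
        have "M (Suc (Suc k)) \<subseteq> M n" using n by (intro M_mono) simp
        then have "I \<subseteq> \<Union>(\<C> (Suc (Suc k)))" using I(1) unfolding M_def by blast
        then obtain J' where J': "J' \<in> \<C> (Suc (Suc k))" "I \<subseteq> J'"
          using member[OF conn_cell[OF I(1)]] I(2) by blast
        have "J' = J" using cell_eq[OF J'(1), of x] cell_eq[OF J] J'(2) I(2) by auto
        with J' have IJ: "I \<subseteq> J" by simp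
        have "1 / real n \<le> 1 / real (Suc n0)" using n by (intro divide_left_mono) auto
        then have "1 / real n \<le> \<delta>" using n0 by linarith
        moreover have "\<delta> \<le> dist y m" if "y \<in> I" "m \<in> M (Suc k)" for y m
        proof -
          have "y \<in> {c..d}" using that(1) IJ cd(1) by auto
          then show ?thesis using \<delta>(2) that(2) by blast
        qed
        ultimately have "Suc k \<in> K n I" using n by (fastforce simp: K_def)
        moreover have "g n x \<in> V n I" using g_cell[OF I] \<psi>(2)[OF I(1) n_pos] by simp
        ultimately have "\<bar>g n x - f (pt I)\<bar> < 2 * e (Suc k)" by (simp add: V_def)
        moreover have "\<bar>f (pt I) - f x\<bar> \<le> e (Suc (Suc k))"
          using J_osc pt[OF I(1) n_pos] IJ J(2) \<open>x \<in> R\<close> by blast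
        moreover have "e (Suc (Suc k)) \<le> e (Suc k)" by (intro e_mono) simp
        ultimately show ?thesis using k unfolding dist_real_def by linarith
      qed
      then show "\<forall>\<^sub>F n in sequentially. dist (g n x) (f x) < \<epsilon>"
        unfolding eventually_sequentially by blast
    qed
  qed
  ultimately show ?thesis
    \<comment> \<open>The sequence is shifted since the oscillating functions are available only for
      positive stages.\<close>
    using that[of "\<lambda>n. g (Suc n)"] LIMSEQ_Suc by blast
qed

theorem mainTheorem5:
  fixes f :: "real \<Rightarrow> real"
  shows "(\<exists>g :: nat \<Rightarrow> real \<Rightarrow> real. (\<forall>n. swiatkowski (g n)) \<and> (\<forall>x. (\<lambda>n. g n x) \<longlonglongrightarrow> f x))
         \<longleftrightarrow> f \<in> frakS"
  using swiatkowski_limit_in_frakS frakS_swiatkowski_limit by metis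

end
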